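(* Let $x\in X$. (a) An eventually conclusive LDO-LC problem has at least one optimal solution $\langle z_t\mid t\in\mathbb{N}^0\rangle\in\mathcal{S}^0(x)$ such that for some $T\in\mathbb{N}$, $z_t=0$ for all $t\ge T$, and if $T>1$, then $\langle z_t\mid t=0,\ldots,T-1\rangle$ solves: Maximize $\sum_{t=0}^{T-1}p^{(t)}x_t$ subject to $x_{t+1}\le c_t+a_tx_t$ for all $t=0,\ldots,T-2$, $0\le x_t\le b$ for all $t=0,\ldots,T-1$, and $x_0=x$. (b) If the problem is strongly eventually conclusive, then there exists $T\in\mathbb{N}$ such that for all $\langle z_t\mid t\in\mathbb{N}^0\rangle\in\mathcal{S}^0(x)$ it is the case that $z_t=0$ for all $t\ge T$, and if $T>1$, then $\langle z_t\mid t=0,\ldots,T-1\rangle$ solves: Maximize $\sum_{t=0}^{T-1}p^{(t)}x_t$ subject to $x_{t+1}\le c_t+a_tx_t$ for all $t=0,\ldots,T-2$, $0\le x_t\le b$ for all $t=0,\ldots,T-1$, and $x_0=x$.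
   Context: $\mathbb{N}$ is the set of strictly positive integers and $\mathbb{N}^0=\mathbb{N}\cup\{0\}$. Fix a real number $b>0$ and let $X=[0,b]\subset\mathbb{R}$. A linear dynamic optimization problem with linear constraints (LDO-LC problem) $\langle(p^{(t)},c_t,a_t)\mid t\in\mathbb{N}^0\rangle$ is given by real sequences with $c_t\ge 0$ and $c_t+a_tb\ge 0$ for all $t\in\mathbb{N}^0$, $\sum_{t=0}^\infty|c_t|<+\infty$, $\sum_{t=0}^\infty|a_t|<+\infty$ and $\sum_{t=0}^\infty|p^{(t)}|<+\infty$. (These imply $c_t+a_tx\ge 0$ for all $x\in X$.) For $t\in\mathbb{N}^0$ and $x\in X$, let $\Omega_t(x)=\{y\in[0,b]\mid y\le c_t+a_tx\}=[0,\min\{c_t+a_tx,b\}]$. For $x\in X$, $\mathcal{F}(x)=\mathcal{F}^0(x)$ is the set of all sequences $\langle x_t\mid t\in\mathbb{N}^0\rangle$ in $X$ with $x_0=x$ and $x_{t+1}\in\Omega_t(x_t)$ for all $t\in\mathbb{N}^0$, and $\mathcal{S}^0(x)=\operatorname{argmax}_{\langle x_t\mid t\in\mathbb{N}^0\rangle\in\mathcal{F}(x)}\sum_{t=0}^\infty p^{(t)}x_t$ is the set of optimal trajectories (optimal solutions) beginning at $x$. An LDO-LC problem is eventually conclusive if there exists $T\in\mathbb{N}$ such that $p^{(t)}\le 0$ for all $t\ge T$; it is strongly eventually conclusive if there exists $T\in\mathbb{N}$ such that $p^{(t)}<0$ for all $t\ge T$. *)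

theory Defs
  imports Complex_Main "HOL-Library.FuncSet"
begin

text \<open>Linear dynamic optimization problems with linear constraints (LDO-LC) on the state
  space \<open>X = {0..b}\<close>. Time runs over all of \<open>nat\<close>, starting at 0.\<close>

locale ldo_lc =
  fixes b :: real and p c a :: "nat \<Rightarrow> real"
  assumes b_pos: "b > 0"
    and c_nonneg: "\<And>t. c t \<ge> 0"
    and c_a_nonneg: "\<And>t. c t + a t * b \<ge> 0"
    and c_summable: "summable (\<lambda>t. \<bar>c t\<bar>)"
    and a_summable: "summable (\<lambda>t. \<bar>a t\<bar>)"
    and p_summable: "summable (\<lambda>t. \<bar>p t\<bar>)"

definition constraint_set :: "real \<Rightarrow> (nat \<Rightarrow> real) \<Rightarrow> (nat \<Rightarrow> real) \<Rightarrow> nat \<Rightarrow> real \<Rightarrow> real set"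
  where "constraint_set b c a t x = {y \<in> {0..b}. y \<le> c t + a t * x}"

definition feasible_trajectories ::
    "real \<Rightarrow> (nat \<Rightarrow> real) \<Rightarrow> (nat \<Rightarrow> real) \<Rightarrow> real \<Rightarrow> (nat \<Rightarrow> real) set"
  where "feasible_trajectories b c a x =
    {y. (\<forall>t. y t \<in> {0..b}) \<and> y 0 = x \<and> (\<forall>t. y (Suc t) \<in> constraint_set b c a t (y t))}"

text \<open>For an LDO-LC problem the series below converges absolutely on every feasible
  trajectory, so \<open>suminf\<close> is the intended infinite sum.\<close>

definition optimal_trajectories ::
    "real \<Rightarrow> (nat \<Rightarrow> real) \<Rightarrow> (nat \<Rightarrow> real) \<Rightarrow> (nat \<Rightarrow> real) \<Rightarrow> real \<Rightarrow> (nat \<Rightarrow> real) set"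
  where "optimal_trajectories b p c a x =
    {z. is_arg_max (\<lambda>y. \<Sum>t. p t * y t) (\<lambda>y. y \<in> feasible_trajectories b c a x) z}"

definition eventually_conclusive :: "(nat \<Rightarrow> real) \<Rightarrow> bool"
  where "eventually_conclusive p \<longleftrightarrow> (\<exists>T>0. \<forall>t\<ge>T. p t \<le> 0)"

definition strongly_eventually_conclusive :: "(nat \<Rightarrow> real) \<Rightarrow> bool"
  where "strongly_eventually_conclusive p \<longleftrightarrow> (\<exists>T>0. \<forall>t\<ge>T. p t < 0)"

text \<open>The finite-horizon problem in the variables \<open>y 0, \<dots>, y (T - 1)\<close>, intended for
  \<open>T > 1\<close>. A finite sequence of length \<open>T\<close> is an extensional function on \<open>{..<T}\<close>; the
  dynamic constraint is imposed for \<open>t = 0, \<dots>, T - 2\<close>.\<close>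

definition finite_feasible ::
    "real \<Rightarrow> (nat \<Rightarrow> real) \<Rightarrow> (nat \<Rightarrow> real) \<Rightarrow> nat \<Rightarrow> real \<Rightarrow> (nat \<Rightarrow> real) set"
  where "finite_feasible b c a T x =
    {y \<in> {..<T} \<rightarrow>\<^sub>E {0..b}. (\<forall>t. Suc t < T \<longrightarrow> y (Suc t) \<le> c t + a t * y t) \<and> y 0 = x}"

definition finite_solutions ::
    "real \<Rightarrow> (nat \<Rightarrow> real) \<Rightarrow> (nat \<Rightarrow> real) \<Rightarrow> (nat \<Rightarrow> real) \<Rightarrow> nat \<Rightarrow> real \<Rightarrow> (nat \<Rightarrow> real) set"
  where "finite_solutions b p c a T x =
    {z. is_arg_max (\<lambda>y. \<Sum>t<T. p t * y t) (\<lambda>y. y \<in> finite_feasible b c a T x) z}"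

end

theory Submission
  imports Defs "HOL-Analysis.Function_Topology"
begin

text \<open>Once all \<open>p t\<close> with \<open>t \<ge> T\<close> are nonpositive, replacing a trajectory by \<open>0\<close> from time \<open>T\<close>
  on keeps it feasible and does not decrease its value, strictly increasing it if \<open>p\<close> is
  negative there and something nonzero was cut off. Hence the problem is equivalent to the one
  over the trajectories vanishing from \<open>T\<close> on, which form a compact set in the product topology,
  and on these the objective is the finite sum up to \<open>T - 1\<close>.\<close>

definition truncate :: "nat \<Rightarrow> (nat \<Rightarrow> real) \<Rightarrow> nat \<Rightarrow> real"
  where "truncate T y = (\<lambda>t. if t < T then y t else 0)"

definition terminating_trajectories ::
    "real \<Rightarrow> (nat \<Rightarrow> real) \<Rightarrow> (nat \<Rightarrow> real) \<Rightarrow> nat \<Rightarrow> real \<Rightarrow> (nat \<Rightarrow> real) set"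
  where "terminating_trajectories b c a T x =
    {y \<in> feasible_trajectories b c a x. \<forall>t\<ge>T. y t = 0}"

text \<open>Each defining condition involves at most two coordinates, and coordinates are continuous
  in the product topology. The set is therefore a closed part of the cube of sequences in
  \<open>{0..b}\<close>, which is compact by Tychonoff.\<close>

lemma compact_terminating_trajectories:
  "compact (terminating_trajectories b c a T x)"
proof -
  have coord: "continuous_on UNIV (\<lambda>y::nat \<Rightarrow> real. y t)" for t
    by (rule continuous_on_product_coordinates)
  have "compactin (product_topology (\<lambda>_. euclidean) (UNIV :: nat set)) (PiE UNIV (\<lambda>_. {0..b}))"
    by (subst compactin_PiE) auto
  then have box: "compact (PiE UNIV (\<lambda>_::nat. {0..b}))"
    by (simp add: euclidean_product_topology)
  have closed: "closed {y::nat \<Rightarrow> real. y 0 = x \<and> (\<forall>t. y (Suc t) \<le> c t + a t * y t) \<and>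
      (\<forall>t. t \<ge> T \<longrightarrow> y t = 0)}"
    \<comment> \<open>The premise \<open>t \<ge> T\<close> does not depend on \<open>y\<close>, so
      it is an open condition, as the closedness rule for implications demands.\<close>
    by (intro closed_Collect_conj closed_Collect_all closed_Collect_imp closed_Collect_eq
        closed_Collect_le open_Collect_const continuous_intros coord)
  have "terminating_trajectories b c a T x = PiE UNIV (\<lambda>_. {0..b}) \<inter>
      {y. y 0 = x \<and> (\<forall>t. y (Suc t) \<le> c t + a t * y t) \<and> (\<forall>t. t \<ge> T \<longrightarrow> y t = 0)}"
    unfolding terminating_trajectories_def feasible_trajectories_def constraint_set_def
    by (auto simp: PiE_iff)
  then show ?thesis
    using compact_Int_closed[OF box closed] by simp
qed

context ldo_lc
begin

text \<open>An affine function on \<open>{0..b}\<close> is a convex combination of its two end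
  values, here \<open>c t\<close> and \<open>c t + a t * b\<close>, with weight
  \<open>y / b\<close>. The consequence used below is that \<open>0\<close> is an admissible
  successor of every state.\<close>

lemma affine_nonneg:
  assumes "y \<in> {0..b}"
  shows "0 \<le> c t + a t * y"
proof -
  have "0 \<le> (1 - y / b) * c t + (y / b) * (c t + a t * b)"
    using assms b_pos
    by (intro add_nonneg_nonneg[OF mult_nonneg_nonneg[OF _ c_nonneg]
          mult_nonneg_nonneg[OF _ c_a_nonneg]]) auto
  also have "\<dots> = c t + a t * y"
    using b_pos by (simp add: field_simps)
  finally show ?thesis .
qed

text \<open>Only times before \<open>T\<close> are constrained, so this serves both to cut off an
  infinite trajectory and to extend a finite-horizon sequence by zeros. \<open>T > 0\<close> keeps
  the initial state intact.\<close>

lemma truncate_mem_terminating: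
  assumes "T > 0" "y 0 = x" "\<And>t. t < T \<Longrightarrow> y t \<in> {0..b}"
    and "\<And>t. Suc t < T \<Longrightarrow> y (Suc t) \<le> c t + a t * y t"
  shows "truncate T y \<in> terminating_trajectories b c a T x"
proof -
  have box: "truncate T y t \<in> {0..b}" for t
    using assms(3)[of t] b_pos by (auto simp: truncate_def)
  moreover have "truncate T y (Suc t) \<le> c t + a t * truncate T y t" for t
  proof (cases "Suc t < T")
    case True
    then show ?thesis using assms(4) by (simp add: truncate_def)
  next
    \<comment> \<open>The left side is \<open>0\<close> here; this includes the drop from the state
      at \<open>T - 1\<close> to \<open>0\<close> at \<open>T\<close>.\<close>
    case False
    then show ?thesis using affine_nonneg[OF box] by (simp add: truncate_def)
  qed
  ultimately show ?thesis
    using assms(1,2)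
    by (auto simp: terminating_trajectories_def feasible_trajectories_def constraint_set_def
        truncate_def)
qed

lemma truncate_feasible:
  assumes "T > 0" "y \<in> feasible_trajectories b c a x"
  shows "truncate T y \<in> terminating_trajectories b c a T x"
  using assms by (intro truncate_mem_terminating)
    (auto simp: feasible_trajectories_def constraint_set_def)

lemma summable_objective:
  assumes "y \<in> feasible_trajectories b c a x"
  shows "summable (\<lambda>t. p t * y t)"
proof (rule summable_comparison_test')
  show "summable (\<lambda>t. \<bar>p t\<bar> * b)"
    using p_summable by (rule summable_mult2)
  show "norm (p t * y t) \<le> \<bar>p t\<bar> * b" for t
    using assms by (auto simp: feasible_trajectories_def abs_mult intro!: mult_left_mono)
qed

lemma suminf_terminating:
  assumes "y \<in> terminating_trajectories b c a T x"
  shows "(\<Sum>t. p t * y t) = (\<Sum>t<T. p t * y t)"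
  using assms by (intro suminf_finite) (auto simp: terminating_trajectories_def)

lemma terminating_feasible:
  "y \<in> terminating_trajectories b c a T x \<Longrightarrow> y \<in> feasible_trajectories b c a x"
  by (simp add: terminating_trajectories_def)

lemma objective_le_truncate:
  assumes "T > 0" "\<And>t. t \<ge> T \<Longrightarrow> p t \<le> 0" and y: "y \<in> feasible_trajectories b c a x"
  shows "(\<Sum>t. p t * y t) \<le> (\<Sum>t. p t * truncate T y t)"
proof (rule suminf_le)
  show "p t * y t \<le> p t * truncate T y t" for t
    using assms(2)[of t] y
    by (auto simp: truncate_def feasible_trajectories_def mult_nonpos_nonneg)
qed (use assms truncate_feasible terminating_feasible summable_objective in blast)+

lemma objective_less_truncate:
  assumes "T > 0" "\<And>t. t \<ge> T \<Longrightarrow> p t < 0" and y: "y \<in> feasible_trajectories b c a x"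
    and s: "s \<ge> T" "y s \<noteq> 0"
  shows "(\<Sum>t. p t * y t) < (\<Sum>t. p t * truncate T y t)"
proof -
  have sy: "summable (\<lambda>t. p t * y t)"
    using y by (rule summable_objective)
  have st: "summable (\<lambda>t. p t * truncate T y t)"
    using assms truncate_feasible terminating_feasible summable_objective by blast
  have nonneg: "y t \<ge> 0" for t
    using y by (auto simp: feasible_trajectories_def)
  \<comment> \<open>The difference vanishes before \<open>T\<close> and equals
    \<open>- p t * y t \<ge> 0\<close> afterwards, strictly so at \<open>s\<close>.\<close>
  have "0 < (\<Sum>t. p t * truncate T y t - p t * y t)"
  proof (rule suminf_pos2)
    show "0 \<le> p t * truncate T y t - p t * y t" for t
      using assms(2)[of t] nonneg[of t] by (auto simp: truncate_def mult_nonpos_nonneg)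
    show "0 < p s * truncate T y s - p s * y s"
      using assms(2)[of s] nonneg[of s] s by (auto simp: truncate_def mult_neg_pos)
  qed (rule summable_diff[OF st sy])
  then show ?thesis
    using suminf_diff[OF st sy] by simp
qed

text \<open>Restriction to \<open>{..<T}\<close> and extension by zeros are mutually inverse between
  terminating trajectories and finite-horizon feasible sequences, and both preserve the sum up to
  \<open>T - 1\<close>.\<close>

lemma finite_solution_terminating:
  assumes "T > 0" and z: "z \<in> terminating_trajectories b c a T x"
    and max: "\<And>y. y \<in> terminating_trajectories b c a T x \<Longrightarrow>
      (\<Sum>t<T. p t * y t) \<le> (\<Sum>t<T. p t * z t)"
  shows "restrict z {..<T} \<in> finite_solutions b p c a T x"
proof -
  have "restrict z {..<T} \<in> finite_feasible b c a T x"
    using assms(1) z by (auto simp: finite_feasible_def terminating_trajectories_def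
        feasible_trajectories_def constraint_set_def)
  moreover have "(\<Sum>t<T. p t * y t) \<le> (\<Sum>t<T. p t * restrict z {..<T} t)"
    if "y \<in> finite_feasible b c a T x" for y
  proof -
    \<comment> \<open>Truncation replaces the \<open>undefined\<close> values of the extensional
      \<open>y\<close> by zeros.\<close>
    have "truncate T y \<in> terminating_trajectories b c a T x"
      using assms(1) that
      by (intro truncate_mem_terminating) (auto simp: finite_feasible_def PiE_iff)
    from max[OF this] show ?thesis
      by (simp add: truncate_def)
  qed
  ultimately show ?thesis
    by (simp add: finite_solutions_def is_arg_max_linorder)
qed

lemma exists_optimal_terminating:
  assumes "T > 0" "\<And>t. t \<ge> T \<Longrightarrow> p t \<le> 0" and x: "x \<in> {0..b}"
  obtains z where "z \<in> optimal_trajectories b p c a x"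
    and "z \<in> terminating_trajectories b c a T x"
proof -
  let ?G = "terminating_trajectories b c a T x"
  \<comment> \<open>The witness is the trajectory that starts at \<open>x\<close> and is
    \<open>0\<close> from time 1 on. Truncating it again at \<open>T \<ge> 1\<close> changes
    nothing, but places it in \<open>?G\<close>.\<close>
  have "truncate 1 (\<lambda>_. x) \<in> terminating_trajectories b c a 1 x"
    using x by (intro truncate_mem_terminating) auto
  then have "truncate T (truncate 1 (\<lambda>_. x)) \<in> ?G"
    by (intro truncate_feasible terminating_feasible assms(1))
  then have "?G \<noteq> {}"
    by blast
  moreover have "continuous_on ?G (\<lambda>y. \<Sum>t<T. p t * y t)"
    by (intro continuous_intros continuous_on_subset[OF continuous_on_product_coordinates]) auto
  ultimately obtain z where z: "z \<in> ?G"
    and max: "\<And>y. y \<in> ?G \<Longrightarrow> (\<Sum>t<T. p t * y t) \<le> (\<Sum>t<T. p t * z t)"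
    using continuous_attains_sup[OF compact_terminating_trajectories] by blast
  \<comment> \<open>An arbitrary feasible \<open>y\<close> is compared with \<open>z\<close> through
    its truncation, which lies in \<open>?G\<close>.\<close>
  have "(\<Sum>t. p t * y t) \<le> (\<Sum>t. p t * z t)" if y: "y \<in> feasible_trajectories b c a x" for y
  proof -
    have tr: "truncate T y \<in> ?G"
      using assms(1) y by (rule truncate_feasible)
    show ?thesis
      using objective_le_truncate[OF assms(1,2) y] max[OF tr]
      by (simp add: suminf_terminating[OF tr] suminf_terminating[OF z])
  qed
  with z have "z \<in> optimal_trajectories b p c a x"
    by (simp add: optimal_trajectories_def is_arg_max_linorder terminating_feasible)
  with z show ?thesis by (rule that[rotated])
qed

lemma optimal_terminating_finite_solution:
  assumes "T > 0" and opt: "z \<in> optimal_trajectories b p c a x"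
    and z: "z \<in> terminating_trajectories b c a T x"
  shows "restrict z {..<T} \<in> finite_solutions b p c a T x"
proof (rule finite_solution_terminating[OF assms(1) z])
  fix y assume y: "y \<in> terminating_trajectories b c a T x"
  then have "(\<Sum>t. p t * y t) \<le> (\<Sum>t. p t * z t)"
    using opt terminating_feasible by (simp add: optimal_trajectories_def is_arg_max_linorder)
  then show "(\<Sum>t<T. p t * y t) \<le> (\<Sum>t<T. p t * z t)"
    by (simp add: suminf_terminating[OF y] suminf_terminating[OF z])
qed

text \<open>If an optimal \<open>z\<close> were nonzero at some time \<open>t \<ge> T\<close>, its
  truncation would be feasible with a strictly larger value.\<close>

lemma optimal_terminating:
  assumes "T > 0" "\<And>t. t \<ge> T \<Longrightarrow> p t < 0" and opt: "z \<in> optimal_trajectories b p c a x"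
  shows "z \<in> terminating_trajectories b c a T x"
proof -
  have z: "z \<in> feasible_trajectories b c a x"
    using opt by (simp add: optimal_trajectories_def is_arg_max_linorder)
  have "(\<Sum>t. p t * truncate T z t) \<le> (\<Sum>t. p t * z t)"
    using opt terminating_feasible[OF truncate_feasible[OF assms(1) z]]
    by (simp add: optimal_trajectories_def is_arg_max_linorder)
  then have "z t = 0" if "t \<ge> T" for t
    using objective_less_truncate[OF assms(1,2) z that] by fastforce
  with z show ?thesis
    by (simp add: terminating_trajectories_def)
qed

end

theorem proposition9:
  fixes b x :: real and p c a :: "nat \<Rightarrow> real"
  assumes "ldo_lc b p c a"
    and "x \<in> {0..b}"
  shows "(eventually_conclusive p \<longrightarrow>
      (\<exists>z \<in> optimal_trajectories b p c a x. \<exists>T>0.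
        (\<forall>t\<ge>T. z t = 0) \<and>
        (T > 1 \<longrightarrow> restrict z {..<T} \<in> finite_solutions b p c a T x)))
    \<and> (strongly_eventually_conclusive p \<longrightarrow>
      (\<exists>T>0. \<forall>z \<in> optimal_trajectories b p c a x.
        (\<forall>t\<ge>T. z t = 0) \<and>
        (T > 1 \<longrightarrow> restrict z {..<T} \<in> finite_solutions b p c a T x)))"
proof -
  interpret ldo_lc b p c a by fact
  have vanish: "\<forall>t\<ge>T. z t = 0" if "z \<in> terminating_trajectories b c a T x" for z T
    using that by (simp add: terminating_trajectories_def)
  show ?thesis
  proof (intro conjI impI)
    assume "eventually_conclusive p"
    then obtain T where T: "T > 0" "\<And>t. t \<ge> T \<Longrightarrow> p t \<le> 0"
      by (auto simp: eventually_conclusive_def)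
    obtain z where "z \<in> optimal_trajectories b p c a x"
      and "z \<in> terminating_trajectories b c a T x"
      using exists_optimal_terminating[OF T assms(2)] by blast
    then show "\<exists>z \<in> optimal_trajectories b p c a x. \<exists>T>0. (\<forall>t\<ge>T. z t = 0) \<and>
        (T > 1 \<longrightarrow> restrict z {..<T} \<in> finite_solutions b p c a T x)"
      using T(1) vanish optimal_terminating_finite_solution by blast
  next
    assume "strongly_eventually_conclusive p"
    then obtain T where T: "T > 0" "\<And>t. t \<ge> T \<Longrightarrow> p t < 0"
      by (auto simp: strongly_eventually_conclusive_def)
    \<comment> \<open>The horizon \<open>T\<close> was obtained from \<open>p\<close> alone, so it
      is uniform in the optimal trajectories.\<close>
    show "\<exists>T>0. \<forall>z \<in> optimal_trajectories b p c a x. (\<forall>t\<ge>T. z t = 0) \<and>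
        (T > 1 \<longrightarrow> restrict z {..<T} \<in> finite_solutions b p c a T x)"
      using T(1) vanish optimal_terminating[OF T] optimal_terminating_finite_solution by blast
  qed
qed

end
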